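(* Let $X$ be a strictly locally convex plane curve in $\mathbb{R}^2$ with unit normal $N$ pointing to the convex side. Let $P$ be a fixed point on $X$ and let $t$ be the tangent line of $X$ at $P$. For sufficiently small $h>0$, let $l$ be the line through $P+hN(P)$ parallel to $t$, let $G$ be the center of gravity of the section of $X$ cut off by $l$, and let $d_P(h)$ be the distance from $G$ to $t$. Then $$\lim_{h\to 0}\frac{d_P(h)}{h}=\frac{3}{5}.$$
   Context: All curves are of class $C^{3}$ and connected. A regular plane curve $X:I\to\mathbb{R}^2$ ($I$ an open interval) is convex if for every $s\in I$ the trace $X(I)$ lies entirely on one side of the tangent line at $s$ (in one of the closed half-planes it determines). It is locally convex if for each $s\in I$ there is an open subinterval $J\subset I$ containing $s$ such that $X|_J$ is convex. A locally convex curve $X$ is called strictly locally convex if it is of class $C^{3}$ and has positive curvature $\kappa$ with respect to the unit normal $N$ pointing to the convex side, i.e. $\kappa(s)=\langle X''(s),N(X(s))\rangle>0$ for an arc-length parametrization $X(s)$. For a point $P$ on $X$ and sufficiently small $h>0$, the line $l$ through $P+hN(P)$ parallel to the tangent at $P$ meets $X$ near $P$ in two points $A,B$, one on each side of $P$ along the curve. The section of $X$ cut off by $l$ is the bounded planar region enclosed by the arc of $X$ from $A$ to $B$ through $P$ and the chord $AB$. Its center of gravity is its centroid (with uniform density). *)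

theory Defs
  imports "HOL-Analysis.Analysis"
begin

abbreviation vderiv :: "(real \<Rightarrow> 'a::real_normed_vector) \<Rightarrow> real \<Rightarrow> 'a" where
  "vderiv f \<equiv> \<lambda>s. vector_derivative f (at s)"

definition open_interval :: "real set \<Rightarrow> bool" where
  "open_interval I \<longleftrightarrow> open I \<and> is_interval I \<and> I \<noteq> {}"

text \<open>For open \<open>I\<close> the two-sided derivatives below only depend on \<open>f\<close> restricted to \<open>I\<close>.\<close>

definition class_C :: "nat \<Rightarrow> (real \<Rightarrow> 'a::real_normed_vector) \<Rightarrow> real set \<Rightarrow> bool" where
  "class_C k f I \<longleftrightarrow>
     (\<forall>i<k. \<forall>s\<in>I. (vderiv ^^ i) f differentiable (at s)) \<and> continuous_on I ((vderiv ^^ k) f)"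

definition regular_C3_curve :: "(real \<Rightarrow> real^2) \<Rightarrow> real set \<Rightarrow> bool" where
  "regular_C3_curve X I \<longleftrightarrow> open_interval I \<and> class_C 3 X I \<and> (\<forall>s\<in>I. vderiv X s \<noteq> 0)"

definition tangent_line :: "(real \<Rightarrow> real^2) \<Rightarrow> real \<Rightarrow> (real^2) set" where
  "tangent_line X s = {X s + c *\<^sub>R vderiv X s | c. True}"

text \<open>The closed half-planes bounded by the tangent line at \<open>s\<close> are the sets
  \<open>{x. 0 \<le> (x - X s) \<bullet> n}\<close> with \<open>n \<noteq> 0\<close> orthogonal to the tangent vector.\<close>

definition convex_curve :: "(real \<Rightarrow> real^2) \<Rightarrow> real set \<Rightarrow> bool" where
  "convex_curve X I \<longleftrightarrow>
     (\<forall>s\<in>I. \<exists>n. n \<noteq> 0 \<and> n \<bullet> vderiv X s = 0 \<and> X ` I \<subseteq> {x. 0 \<le> (x - X s) \<bullet> n})"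

definition locally_convex_curve :: "(real \<Rightarrow> real^2) \<Rightarrow> real set \<Rightarrow> bool" where
  "locally_convex_curve X I \<longleftrightarrow>
     (\<forall>s\<in>I. \<exists>J. open_interval J \<and> s \<in> J \<and> J \<subseteq> I \<and> convex_curve X J)"

text \<open>Locally convex curves may intersect themselves, so the normal is a function of the
  parameter and not of the point of the trace.\<close>

definition unit_normal_to_convex_side ::
    "(real \<Rightarrow> real^2) \<Rightarrow> real set \<Rightarrow> (real \<Rightarrow> real^2) \<Rightarrow> bool" where
  "unit_normal_to_convex_side X I N \<longleftrightarrow>
     (\<forall>s\<in>I. norm (N s) = 1 \<and> N s \<bullet> vderiv X s = 0 \<and>
        (\<exists>J. open_interval J \<and> s \<in> J \<and> J \<subseteq> I \<and> X ` J \<subseteq> {x. 0 \<le> (x - X s) \<bullet> N s}))"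

definition arc_length_change ::
    "(real \<Rightarrow> real^2) \<Rightarrow> real set \<Rightarrow> (real \<Rightarrow> real) \<Rightarrow> real set \<Rightarrow> bool" where
  "arc_length_change X I \<phi> J \<longleftrightarrow>
     open_interval J \<and> bij_betw \<phi> J I \<and> class_C 3 \<phi> J \<and>
     (\<forall>\<sigma>\<in>J. norm (vderiv (X \<circ> \<phi>) \<sigma>) = 1)"

text \<open>Every regular curve of class C3 has an arc-length parametrization \<open>X \<circ> \<phi>\<close>, and the curvature
  with respect to \<open>N\<close> does not depend on its choice, so the existential quantifier over \<open>\<phi>\<close> could
  equally be a universal one.\<close>

definition strictly_locally_convex ::
    "(real \<Rightarrow> real^2) \<Rightarrow> real set \<Rightarrow> (real \<Rightarrow> real^2) \<Rightarrow> bool" where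
  "strictly_locally_convex X I N \<longleftrightarrow>
     regular_C3_curve X I \<and> locally_convex_curve X I \<and> unit_normal_to_convex_side X I N \<and>
     (\<exists>\<phi> J. arc_length_change X I \<phi> J \<and>
        (\<forall>\<sigma>\<in>J. 0 < vderiv (vderiv (X \<circ> \<phi>)) \<sigma> \<bullet> N (\<phi> \<sigma>)))"

definition parallel_line ::
    "(real \<Rightarrow> real^2) \<Rightarrow> (real \<Rightarrow> real^2) \<Rightarrow> real \<Rightarrow> real \<Rightarrow> (real^2) set" where
  "parallel_line X N p h = {X p + h *\<^sub>R N p + c *\<^sub>R vderiv X p | c. True}"

text \<open>The two intersection points near \<open>X p\<close> are the first points of the line met when leaving
  \<open>X p\<close> along the curve in either direction. They are unique whenever they exist.\<close>

definition cut_parameters ::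
    "(real \<Rightarrow> real^2) \<Rightarrow> real set \<Rightarrow> (real \<Rightarrow> real^2) \<Rightarrow> real \<Rightarrow> real \<Rightarrow> real \<Rightarrow> real \<Rightarrow> bool" where
  "cut_parameters X I N p h a b \<longleftrightarrow>
     a \<in> I \<and> b \<in> I \<and> a < p \<and> p < b \<and>
     X a \<in> parallel_line X N p h \<and> X b \<in> parallel_line X N p h \<and>
     (\<forall>u\<in>{a<..<b}. X u \<notin> parallel_line X N p h)"

lemma cut_parameters_unique:
  assumes "cut_parameters X I N p h a b" "cut_parameters X I N p h a' b'"
  shows "a = a'" "b = b'"
  using assms unfolding cut_parameters_def
  by (metis greaterThanLessThan_iff less_trans linorder_neqE)+

definition curve_section ::
    "(real \<Rightarrow> real^2) \<Rightarrow> real set \<Rightarrow> (real \<Rightarrow> real^2) \<Rightarrow> real \<Rightarrow> real \<Rightarrow> (real^2) set" where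
  "curve_section X I N p h =
     (THE S. \<exists>a b. cut_parameters X I N p h a b \<and>
        S = inside (X ` {a..b} \<union> closed_segment (X a) (X b)))"

definition center_of_gravity :: "(real^2) set \<Rightarrow> real^2" where
  "center_of_gravity S = (1 / measure lebesgue S) *\<^sub>R integral S (\<lambda>x. x)"

definition dist_center_tangent ::
    "(real \<Rightarrow> real^2) \<Rightarrow> real set \<Rightarrow> (real \<Rightarrow> real^2) \<Rightarrow> real \<Rightarrow> real \<Rightarrow> real" where
  "dist_center_tangent X I N p h =
     infdist (center_of_gravity (curve_section X I N p h)) (tangent_line X p)"

end

theory Submission
  imports Defs
begin

text \<open>Take \<open>P\<close> as origin, with abscissa along the tangent and ordinate along the normal. Since the
  curvature is positive, near \<open>P\<close> the curve is a graph lying between two parabolas \<open>k\<^sub>1 \<xi>\<^sup>2\<close> and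
  \<open>k\<^sub>2 \<xi>\<^sup>2\<close> with \<open>k\<^sub>2 / k\<^sub>1\<close> arbitrarily close to 1, so the section lies between two parabolic
  caps of height \<open>h\<close>. Area and first moment are monotone, and those of a cap are obtained by a linear
  change of variables from those of the cap of height 1 under \<open>\<xi>\<^sup>2\<close>. For that cap the ratio of
  moment to area is 3/5 by self-similarity: the areas and moments of the caps of height \<open>h\<close> are
  \<open>A h\<^bsup>3/2\<^esup>\<close> and \<open>M h\<^bsup>5/2\<^esup>\<close>, and the thin strip between heights 1 and \<open>h\<close> has a moment
  asymptotic to its area, so that \<open>5/2 M = 3/2 A\<close>.\<close>

section \<open>Orthonormal frames in the plane\<close>

lemma orthonormal_components:
  fixes T N x :: "real^2"
  assumes "norm T = 1" "norm N = 1" "T \<bullet> N = 0"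
  shows "x = (x \<bullet> T) *\<^sub>R T + (x \<bullet> N) *\<^sub>R N"
proof -
  have e: "T$1*T$1 + T$2*T$2 = 1" "N$1*N$1 + N$2*N$2 = 1" "T$1*N$1 + T$2*N$2 = 0"
    using assms by (simp_all add: norm_eq_1 inner_vec_def sum_2)
  \<comment> \<open>\<open>D\<close> is the determinant of the frame. The relations in
    \<open>e\<close> force \<open>N\<close> to be \<open>D\<close> times \<open>T\<close> turned by
    a right angle, and \<open>D\<close> squares to 1.\<close>
  define D where "D = T$1*N$2 - T$2*N$1"
  have n: "N$1 = - (D*T$2)" "N$2 = D*T$1" using e unfolding D_def by algebra+
  have "D*D = 1" using e unfolding D_def by algebra
  then have "x$1 = (x$1*T$1 + x$2*T$2)*T$1 + (x$1*N$1 + x$2*N$2)*N$1"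
    "x$2 = (x$1*T$1 + x$2*T$2)*T$2 + (x$1*N$1 + x$2*N$2)*N$2"
    using e(1) unfolding n by algebra+
  then show ?thesis by (simp add: vec_eq_iff forall_2 inner_vec_def sum_2)
qed

lemma norm_le_orthonormal_components:
  fixes T N x :: "real^2"
  assumes "norm T = 1" "norm N = 1" "T \<bullet> N = 0"
  shows "norm x \<le> \<bar>x \<bullet> T\<bar> + \<bar>x \<bullet> N\<bar>"
proof -
  have "norm x = norm ((x \<bullet> T) *\<^sub>R T + (x \<bullet> N) *\<^sub>R N)"
    by (rule arg_cong[OF orthonormal_components[OF assms]])
  also have "\<dots> \<le> \<bar>x \<bullet> T\<bar> + \<bar>x \<bullet> N\<bar>"
    using norm_triangle_ineq[of "(x \<bullet> T) *\<^sub>R T" "(x \<bullet> N) *\<^sub>R N"] assms by simp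
  finally show ?thesis .
qed

section \<open>Area and first moment of parabolic caps\<close>

text \<open>Caps and sections are open and bounded, so this covers the integrability of constants,
  of the height and of the position vector on all of them.\<close>

lemma absolutely_integrable_continuous_bounded_open:
  fixes \<phi> :: "'a::euclidean_space \<Rightarrow> 'b::euclidean_space"
  assumes "continuous_on UNIV \<phi>" "open S" "bounded S"
  shows "\<phi> absolutely_integrable_on S"
proof -
  obtain a where a: "S \<subseteq> cbox (-a) a" using bounded_subset_cbox_symmetric[OF assms(3)] by blast
  have "\<phi> absolutely_integrable_on cbox (-a) a"
    by (rule absolutely_integrable_continuous) (use assms(1) continuous_on_subset in blast)
  then show ?thesis
    by (rule set_integrable_subset) (use assms a in \<open>auto\<close>)
qed

text \<open>\<open>q\<close> is the vertex and \<open>N\<close> the direction of the axis. The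
  strict inequalities make the cap open, hence measurable, and match the description of the enclosed
  region in \<open>inside_graph_chord\<close>.\<close>

definition parabolic_cap :: "real^2 \<Rightarrow> real^2 \<Rightarrow> real^2 \<Rightarrow> real \<Rightarrow> real \<Rightarrow> (real^2) set" where
  "parabolic_cap q T N k h = {x. k * ((x - q) \<bullet> T)\<^sup>2 < (x - q) \<bullet> N \<and> (x - q) \<bullet> N < h}"

lemma open_parabolic_cap: "open (parabolic_cap q T N k h)"
  unfolding parabolic_cap_def Collect_conj_eq
  by (intro open_Int open_Collect_less continuous_intros)

lemma bounded_parabolic_cap:
  assumes "norm T = 1" "norm N = 1" "T \<bullet> N = 0" "0 < k"
  shows "bounded (parabolic_cap q T N k h)"
proof -
  have "norm x \<le> norm q + sqrt (h/k) + h" if "x \<in> parabolic_cap q T N k h" for x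
  proof -
    have *: "k * ((x - q) \<bullet> T)\<^sup>2 < (x - q) \<bullet> N" "(x - q) \<bullet> N < h" using that by (auto simp: parabolic_cap_def)
    have "((x - q) \<bullet> T)\<^sup>2 \<le> h/k" using * assms by (simp add: pos_le_divide_eq mult.commute)
    then have 1: "\<bar>(x - q) \<bullet> T\<bar> \<le> sqrt (h/k)" by (metis real_sqrt_abs real_sqrt_le_mono)
    have "0 \<le> k * ((x - q) \<bullet> T)\<^sup>2" using assms by simp
    then have 2: "\<bar>(x - q) \<bullet> N\<bar> \<le> h" using * by linarith
    have "norm x \<le> norm q + norm (x - q)" by (metis add.commute norm_triangle_sub)
    also have "norm (x - q) \<le> \<bar>(x - q) \<bullet> T\<bar> + \<bar>(x - q) \<bullet> N\<bar>"
      by (rule norm_le_orthonormal_components[OF assms(1-3)])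
    finally show ?thesis using 1 2 by linarith
  qed
  then show ?thesis unfolding bounded_iff by blast
qed

text \<open>The Jacobian needed in \<open>integral_parabolic_cap_scale\<close>: an orthonormal frame
  has determinant 1 or -1, and the absolute value makes its orientation irrelevant.\<close>

lemma matrix_frame_det:
  fixes T N :: "real^2"
  assumes "norm T = 1" "norm N = 1" "T \<bullet> N = 0"
  shows "\<bar>det (matrix (\<lambda>v::real^2. (\<alpha> * v$1) *\<^sub>R T + (\<beta> * v$2) *\<^sub>R N))\<bar> = \<bar>\<alpha> * \<beta>\<bar>"
proof -
  have e: "T$1*T$1 + T$2*T$2 = 1" "N$1*N$1 + N$2*N$2 = 1" "T$1*N$1 + T$2*N$2 = 0"
    using assms by (simp_all add: norm_eq_1 inner_vec_def sum_2)
  have "(T$1*N$2 - T$2*N$1)\<^sup>2 = 1" using e by algebra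
  then have D: "\<bar>T$1*N$2 - T$2*N$1\<bar> = 1" by (metis power2_eq_1_iff abs_1 abs_minus_cancel)
  have "det (matrix (\<lambda>v::real^2. (\<alpha> * v$1) *\<^sub>R T + (\<beta> * v$2) *\<^sub>R N)) = (\<alpha>*\<beta>) * (T$1*N$2 - T$2*N$1)"
    by (simp add: det_2 matrix_def axis_def algebra_simps)
  then show ?thesis by (simp add: abs_mult D)
qed

text \<open>An affine map stretching by \<open>sqrt (h/k)\<close> along \<open>T\<close> and by
  \<open>h\<close> along \<open>N\<close> carries the cap of height 1 under the standard parabola
  onto the given cap.\<close>

lemma integral_parabolic_cap_scale:
  fixes \<phi> :: "real^2 \<Rightarrow> real"
  assumes ON: "norm T = 1" "norm N = 1" "T \<bullet> N = 0" and k: "0 < k" and h: "0 < h"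
    and \<phi>: "continuous_on UNIV \<phi>"
  shows "integral (parabolic_cap q T N k h) \<phi> = h * sqrt (h/k) *
    integral (parabolic_cap 0 (axis 1 1) (axis 2 1) 1 1)
      (\<lambda>v. \<phi> (q + (sqrt (h/k) * v$1) *\<^sub>R T + (h * v$2) *\<^sub>R N))"
proof -
  \<comment> \<open>\<alpha> solves \<open>k * \<alpha>\<^sup>2 = h\<close>, so that both defining
    inequalities of the cap become those of \<open>?P\<close> after division by
    \<open>h\<close>.\<close>
  define \<alpha> where "\<alpha> = sqrt (h/k)"
  have \<alpha>: "\<alpha> > 0" "k * \<alpha>\<^sup>2 = h" using k h by (auto simp: \<alpha>_def)
  let ?P = "parabolic_cap 0 (axis 1 1) (axis 2 1) 1 1"
  let ?L = "\<lambda>v::real^2. (\<alpha> * v$1) *\<^sub>R T + (h * v$2) *\<^sub>R N"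
  let ?g = "\<lambda>v::real^2. q + (\<alpha> * v$1) *\<^sub>R T + (h * v$2) *\<^sub>R N"
  \<comment> \<open>The change of variables is applied to a vector-valued integrand, so \<phi> is
    carried along this fixed vector, which is cancelled at the end.\<close>
  let ?e = "axis 1 1 :: real^2"
  have NT: "N \<bullet> T = 0" "T \<bullet> T = 1" "N \<bullet> N = 1" using ON by (auto simp: inner_commute norm_eq_1)
  have gT: "(?g v - q) \<bullet> T = \<alpha> * v$1" and gN: "(?g v - q) \<bullet> N = h * v$2" for v
    using ON NT by (simp_all add: inner_add_left inner_diff_left)
  have P: "v \<in> ?P \<longleftrightarrow> (v$1)\<^sup>2 < v$2 \<and> v$2 < 1" for v
    by (simp add: parabolic_cap_def inner_axis)
  have gP: "?g v \<in> parabolic_cap q T N k h \<longleftrightarrow> v \<in> ?P" for v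
  proof -
    have "k * (\<alpha> * v$1)\<^sup>2 = h * (v$1)\<^sup>2" using \<alpha>(2) by (simp add: power_mult_distrib mult.assoc[symmetric])
    then show ?thesis unfolding parabolic_cap_def[of q] mem_Collect_eq gT gN P using h by simp
  qed
  have img: "?g ` ?P = parabolic_cap q T N k h"
  proof
    show "?g ` ?P \<subseteq> parabolic_cap q T N k h" using gP by blast
    show "parabolic_cap q T N k h \<subseteq> ?g ` ?P"
    proof
      fix x assume x: "x \<in> parabolic_cap q T N k h"
      define v :: "real^2" where "v = vector [(x - q) \<bullet> T / \<alpha>, (x - q) \<bullet> N / h]"
      have "?g v = q + (((x - q) \<bullet> T) *\<^sub>R T + ((x - q) \<bullet> N) *\<^sub>R N)"
        using \<alpha>(1) h by (simp add: v_def add.assoc del: inner_simps)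
      then have "?g v = x" unfolding orthonormal_components[OF ON, of "x - q", symmetric] by simp
      moreover from this have "v \<in> ?P" using gP[of v] x by simp
      ultimately show "x \<in> ?g ` ?P" by (rule image_eqI[OF sym])
    qed
  qed
  have inj: "inj_on ?g ?P"
  proof
    fix v w assume "?g v = ?g w"
    then have "\<alpha> * v$1 = \<alpha> * w$1" "h * v$2 = h * w$2" using gT[of v] gT[of w] gN[of v] gN[of w] by simp_all
    then show "v = w" using \<alpha> h by (simp add: vec_eq_iff forall_2)
  qed
  have der: "(?g has_derivative ?L) (at v within ?P)" for v
    by (auto intro!: derivative_eq_intros bounded_linear_imp_has_derivative bounded_linear_vec_nth)
  have det: "\<bar>det (matrix ?L)\<bar> = h * \<alpha>" using matrix_frame_det[OF ON, of \<alpha> h] \<alpha> h by (simp add: mult.commute)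
  have ai: "(\<lambda>x. \<phi> x *\<^sub>R ?e) absolutely_integrable_on parabolic_cap q T N k h"
    by (rule absolutely_integrable_continuous_bounded_open)
      (use open_parabolic_cap bounded_parabolic_cap[OF ON k] \<phi> in \<open>auto intro!: continuous_intros\<close>)
  have cg: "continuous_on UNIV (\<lambda>v. \<phi> (?g v))"
    by (rule continuous_on_compose2[OF \<phi>]) (auto intro!: continuous_intros)
  have 1: "\<phi> integrable_on parabolic_cap q T N k h"
    using absolutely_integrable_continuous_bounded_open[OF \<phi> open_parabolic_cap bounded_parabolic_cap[OF ON k]]
    by (simp add: absolutely_integrable_on_def)
  have 2: "(\<lambda>v. \<phi> (?g v)) integrable_on ?P"
    using absolutely_integrable_continuous_bounded_open[OF cg open_parabolic_cap bounded_parabolic_cap[of "axis 1 1" "axis 2 1" 1]]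
    by (simp add: absolutely_integrable_on_def inner_axis_axis)
  have "integral (?g ` ?P) (\<lambda>x. \<phi> x *\<^sub>R ?e) = integral ?P (\<lambda>v. \<bar>det (matrix ?L)\<bar> *\<^sub>R (\<phi> (?g v) *\<^sub>R ?e))"
    by (rule integral_change_of_variables[OF _ der inj])
       (use ai img open_parabolic_cap in \<open>auto\<close>)
  then have "integral (parabolic_cap q T N k h) (\<lambda>x. \<phi> x *\<^sub>R ?e) = (h * \<alpha>) *\<^sub>R integral ?P (\<lambda>v. \<phi> (?g v) *\<^sub>R ?e)"
    unfolding img det by (simp only: integral_cmul)
  moreover have "integral (parabolic_cap q T N k h) (\<lambda>x. \<phi> x *\<^sub>R ?e) = integral (parabolic_cap q T N k h) \<phi> *\<^sub>R ?e"
    using 1 by (intro integral_unique has_integral_scaleR_left) (simp add: has_integral_integral)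
  moreover have "integral ?P (\<lambda>v. \<phi> (?g v) *\<^sub>R ?e) = integral ?P (\<lambda>v. \<phi> (?g v)) *\<^sub>R ?e"
    using 2 by (intro integral_unique has_integral_scaleR_left) (simp add: has_integral_integral)
  ultimately have "integral (parabolic_cap q T N k h) \<phi> *\<^sub>R ?e = (h * \<alpha> * integral ?P (\<lambda>v. \<phi> (?g v))) *\<^sub>R ?e"
    by simp
  then show ?thesis unfolding \<alpha>_def[symmetric] by (simp add: axis_eq_0_iff)
qed

definition unit_cap :: "(real^2) set" where
  "unit_cap = parabolic_cap 0 (axis 1 1) (axis 2 1) 1 1"

text \<open>The scaling exponents of \<open>h\<close> are 3/2 for the area and 5/2 for the moment.
  The coefficient \<open>k\<close> enters both through the same factor, so it drops out of their
  ratio.\<close>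

lemma integral_parabolic_cap:
  assumes ON: "norm T = 1" "norm N = 1" "T \<bullet> N = 0" and k: "0 < k" and h: "0 < h"
  shows "integral (parabolic_cap q T N k h) (\<lambda>x. 1) = h * sqrt (h/k) * integral unit_cap (\<lambda>v. 1)"
    and "integral (parabolic_cap q T N k h) (\<lambda>x. (x - q) \<bullet> N) = h\<^sup>2 * sqrt (h/k) * integral unit_cap (\<lambda>v. v$2)"
proof -
  have NT: "N \<bullet> N = 1" using ON by (auto simp: inner_commute norm_eq_1)
  have gN: "(q + (a * v$1) *\<^sub>R T + (h * v$2) *\<^sub>R N - q) \<bullet> N = h * v$2" for a and v :: "real^2"
    using ON NT by (simp_all add: inner_add_left inner_diff_left)
  show "integral (parabolic_cap q T N k h) (\<lambda>x. 1) = h * sqrt (h/k) * integral unit_cap (\<lambda>v. 1)"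
    unfolding unit_cap_def by (rule integral_parabolic_cap_scale[OF assms]) simp
  show "integral (parabolic_cap q T N k h) (\<lambda>x. (x - q) \<bullet> N) = h\<^sup>2 * sqrt (h/k) * integral unit_cap (\<lambda>v. v$2)"
    unfolding unit_cap_def power2_eq_square
    by (subst integral_parabolic_cap_scale[OF assms], intro continuous_intros)
       (simp only: gN integral_mult_right, simp)
qed

lemma unit_cap_area_pos: "integral unit_cap (\<lambda>v. 1::real) > 0"
proof -
  have o: "open unit_cap" "bounded unit_cap"
    unfolding unit_cap_def by (auto intro!: open_parabolic_cap bounded_parabolic_cap simp: inner_axis_axis)
  have "vector [0, 1/2] \<in> unit_cap" by (auto simp: unit_cap_def parabolic_cap_def inner_axis)
  then have "\<not> negligible unit_cap" using o(1) open_not_negligible by blast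
  moreover have "unit_cap \<in> lmeasurable" using o by (rule_tac lmeasurable_open) auto
  ultimately have "measure lebesgue unit_cap > 0"
    by (metis measure_nonneg negligible_iff_measure order_le_less)
  then show ?thesis using \<open>unit_cap \<in> lmeasurable\<close> by (simp add: lmeasure_integral)
qed

text \<open>On the difference of the caps of heights \<open>h\<close> and 1 the ordinate lies
  between 1 and \<open>h\<close>, so the moment of this strip lies between its area and
  \<open>h\<close> times its area.\<close>

lemma integral_parabolic_cap_strip:
  assumes "1 \<le> h"
  defines "A \<equiv> integral unit_cap (\<lambda>v. 1::real)" and "M \<equiv> integral unit_cap (\<lambda>v. v$2)"
  shows "(h * sqrt h - 1) * A \<le> (h\<^sup>2 * sqrt h - 1) * M"
    and "(h\<^sup>2 * sqrt h - 1) * M \<le> h * ((h * sqrt h - 1) * A)"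
proof -
  let ?P = "\<lambda>h. parabolic_cap 0 (axis 1 1) (axis 2 1) 1 h :: (real^2) set"
  have ON: "norm (axis 1 1 :: real^2) = 1" "norm (axis 2 1 :: real^2) = 1" "axis 1 1 \<bullet> (axis 2 1 :: real^2) = 0"
    by (auto simp: inner_axis_axis)
  have sub: "?P 1 \<subseteq> ?P h" using assms(1) by (auto simp: parabolic_cap_def)
  have I: "\<phi> integrable_on ?P r" if "continuous_on UNIV \<phi>" for r and \<phi> :: "real^2 \<Rightarrow> real"
    using absolutely_integrable_continuous_bounded_open[OF that open_parabolic_cap bounded_parabolic_cap[OF ON, of 1]]
    by (simp add: absolutely_integrable_on_def)
  have S: "(\<phi> has_integral (integral (?P h) \<phi> - integral (?P 1) \<phi>)) (?P h - ?P 1)"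
    if "continuous_on UNIV \<phi>" for \<phi> :: "real^2 \<Rightarrow> real"
    by (rule has_integral_setdiff) (use I[OF that] sub in \<open>auto simp: has_integral_integral[symmetric]\<close>)
  have a: "integral (?P r) (\<lambda>x. 1) = r * sqrt r * A" "integral (?P r) (\<lambda>x. x$2) = r\<^sup>2 * sqrt r * M" if "0 < r" for r
    using integral_parabolic_cap[OF ON, of 1 r 0] that by (auto simp: A_def M_def inner_axis)
  have s1: "((\<lambda>x. 1) has_integral ((h * sqrt h - 1) * A)) (?P h - ?P 1)"
    using S[of "\<lambda>x. 1"] a(1)[of h] a(1)[of 1] assms(1) by (simp add: algebra_simps)
  have s2: "((\<lambda>x. x$2) has_integral ((h\<^sup>2 * sqrt h - 1) * M)) (?P h - ?P 1)"
    using S[of "\<lambda>x. x$2"] a(2)[of h] a(2)[of 1] assms(1) by (simp add: algebra_simps continuous_on_component)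
  show "(h * sqrt h - 1) * A \<le> (h\<^sup>2 * sqrt h - 1) * M"
    by (rule has_integral_le[OF s1 s2]) (auto simp: parabolic_cap_def inner_axis)
  have s3: "((\<lambda>x. h * 1) has_integral (h * ((h * sqrt h - 1) * A))) (?P h - ?P 1)"
    by (rule has_integral_mult_right[OF s1])
  show "(h\<^sup>2 * sqrt h - 1) * M \<le> h * ((h * sqrt h - 1) * A)"
    by (rule has_integral_le[OF s2 s3]) (auto simp: parabolic_cap_def inner_axis)
qed

text \<open>The strip inequalities are divided by \<open>h - 1\<close> and \<open>h\<close>
  decreases to 1. The difference quotients tend to the derivatives of the scaling laws, and the two
  inequalities close up to an equation between them.\<close>

lemma unit_cap_moment:
  "integral unit_cap (\<lambda>v. v$2) = 3/5 * integral unit_cap (\<lambda>v. 1)"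
proof -
  define A M where "A = integral unit_cap (\<lambda>v. 1::real)" and "M = integral unit_cap (\<lambda>v. v$2)"
  have d3: "((\<lambda>h::real. h * sqrt h * A) has_field_derivative 3/2 * A) (at 1)"
    by (auto intro!: derivative_eq_intros)
  have d5: "((\<lambda>h::real. h\<^sup>2 * sqrt h * M) has_field_derivative 5/2 * M) (at 1)"
    by (auto intro!: derivative_eq_intros)
  have l3: "((\<lambda>h. (h * sqrt h * A - A) / (h - 1)) \<longlongrightarrow> 3/2 * A) (at_right 1)"
    using d3 unfolding has_field_derivative_iff by (auto intro: filterlim_mono at_le simp: at_within_le_at)
  have l5: "((\<lambda>h. (h\<^sup>2 * sqrt h * M - M) / (h - 1)) \<longlongrightarrow> 5/2 * M) (at_right 1)"
    using d5 unfolding has_field_derivative_iff by (auto intro: filterlim_mono at_le simp: at_within_le_at)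
  have ev: "\<forall>\<^sub>F h in at_right (1::real). h > 1" by (simp add: eventually_at_right_less)
  have "3/2 * A \<le> 5/2 * M"
  proof (rule tendsto_le[OF _ l5 l3])
    show "\<forall>\<^sub>F h in at_right 1. (h * sqrt h * A - A) / (h - 1) \<le> (h\<^sup>2 * sqrt h * M - M) / (h - 1)"
      using ev by eventually_elim
        (use integral_parabolic_cap_strip(1) in \<open>auto intro!: divide_right_mono simp: A_def M_def algebra_simps\<close>)
  qed simp
  \<comment> \<open>The factor 1 is the limit of the upper bound \<open>h\<close> of the ordinate on
    the strip.\<close>
  moreover have "5/2 * M \<le> 1 * (3/2 * A)"
  proof (rule tendsto_le[OF _ tendsto_mult[OF _ l3] l5])
    show "((\<lambda>h. h) \<longlongrightarrow> 1) (at_right (1::real))" by (rule tendsto_ident_at)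
    show "\<forall>\<^sub>F h in at_right 1. (h\<^sup>2 * sqrt h * M - M) / (h - 1) \<le> h * ((h * sqrt h * A - A) / (h - 1))"
      using ev
    proof eventually_elim
      case (elim h)
      then have "(h\<^sup>2 * sqrt h * M - M) \<le> h * (h * sqrt h * A - A)"
        using integral_parabolic_cap_strip(2)[of h] by (simp add: A_def M_def algebra_simps)
      then show ?case using elim by (simp add: divide_right_mono)
    qed
  qed simp
  ultimately show ?thesis unfolding A_def M_def by simp
qed

section \<open>The region enclosed by a graph and a chord\<close>

text \<open>A ray avoiding \<open>C\<close> is connected and unbounded, so it puts its origin into
  an unbounded component of the complement.\<close>

lemma not_inside_ray:
  fixes x v :: "'a::real_normed_vector"
  assumes "v \<noteq> 0" "\<And>t. 0 \<le> t \<Longrightarrow> x + t *\<^sub>R v \<notin> C"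
  shows "x \<notin> inside C"
proof
  assume "x \<in> inside C"
  then have b: "bounded (connected_component_set (- C) x)" by (simp add: inside_def)
  let ?R = "(\<lambda>t. x + t *\<^sub>R v) ` {0..}"
  have "connected ?R" by (intro connected_continuous_image continuous_intros) auto
  moreover have "x \<in> ?R" by (rule image_eqI[of _ _ 0]) auto
  moreover have "?R \<subseteq> - C" using assms(2) by auto
  ultimately have "?R \<subseteq> connected_component_set (- C) x" by (intro connected_component_maximal)
  then have "bounded ?R" using b bounded_subset by blast
  then obtain B where B: "\<And>t. 0 \<le> t \<Longrightarrow> norm (x + t *\<^sub>R v) \<le> B" unfolding bounded_iff by force
  \<comment> \<open>Far enough along the ray for the norm to exceed the supposed bound
    \<open>B\<close>.\<close>
  define t where "t = (\<bar>B\<bar> + norm x + 1) / norm v"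
  have t: "t \<ge> 0" "t * norm v = \<bar>B\<bar> + norm x + 1" using assms(1) by (auto simp: t_def)
  have "norm (t *\<^sub>R v) \<le> norm (x + t *\<^sub>R v) + norm x"
    by (metis add_diff_cancel_left' norm_triangle_ineq4)
  also have "norm (t *\<^sub>R v) = \<bar>B\<bar> + norm x + 1" using t(1) unfolding norm_scaleR t(2)[symmetric] by simp
  finally show False using B[OF t(1)] by linarith
qed

text \<open>A connected set that starts in \<open>S\<close> and leaves it must cross the frontier,
  which lies in \<open>C\<close>. The component of \<open>x\<close> in the complement of
  \<open>C\<close> therefore stays in the bounded set \<open>S\<close>.\<close>

lemma mem_inside_frontier:
  fixes S :: "'a::real_normed_vector set"
  assumes "x \<in> S" "S \<inter> C = {}" "bounded S" "frontier S \<subseteq> C"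
  shows "x \<in> inside C"
proof -
  have "connected_component_set (- C) x \<subseteq> S"
  proof (rule ccontr)
    assume n: "\<not> ?thesis"
    have "x \<in> connected_component_set (- C) x" using assms by auto
    then have "connected_component_set (- C) x \<inter> frontier S \<noteq> {}"
      using n assms(1) by (intro connected_Int_frontier connected_connected_component) blast+
    then show False using assms(4) connected_component_subset[of "- C" x] by blast
  qed
  then show ?thesis using assms bounded_subset unfolding inside_def by blast
qed

text \<open>A point off the region escapes to infinity along a vertical ray; conversely the region is open
  and bounded with frontier contained in the curve, so no component of the complement leaves it.\<close>

lemma inside_graph_chord:
  fixes q T N :: "real^2"
  assumes ON: "norm T = 1" "norm N = 1" "T \<bullet> N = 0"
    and F: "continuous_on {c..d} F" and cd: "c < d" and Fcd: "F c = h" "F d = h"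
    and Flt: "\<And>\<xi>. c < \<xi> \<Longrightarrow> \<xi> < d \<Longrightarrow> F \<xi> < h"
    and C: "C = {x. (x - q) \<bullet> T \<in> {c..d} \<and> ((x - q) \<bullet> N = F ((x - q) \<bullet> T) \<or> (x - q) \<bullet> N = h)}"
  shows "inside C = {x. (x - q) \<bullet> T \<in> {c<..<d} \<and> F ((x - q) \<bullet> T) < (x - q) \<bullet> N \<and> (x - q) \<bullet> N < h}"
    (is "_ = ?S")
proof
  have NT: "N \<bullet> T = 0" "N \<bullet> N = 1" using ON by (auto simp: inner_commute norm_eq_1)
  have N0: "N \<noteq> 0" using ON by auto
  have Fle: "F \<xi> \<le> h" if "\<xi> \<in> {c..d}" for \<xi>
    using that Fcd Flt[of \<xi>] by (cases "\<xi> = c \<or> \<xi> = d") auto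
  show "inside C \<subseteq> ?S"
  proof
    fix x assume x: "x \<in> inside C"
    have xC: "x \<notin> C" using x inside_no_overlap by blast
    \<comment> \<open>Both vertical rays from \<open>x\<close> meet \<open>C\<close>, at heights
      equal to \<open>F \<xi>\<close> or \<open>h\<close>. The upper hit puts \<open>x\<close> at
      height at most \<open>h\<close>, the lower one at height at least \<open>F \<xi>\<close>, and
      both bounds are strict because \<open>x\<close> is not on \<open>C\<close>.\<close>
    have "\<exists>t\<ge>0. x + t *\<^sub>R N \<in> C" using not_inside_ray[OF N0] x by blast
    then obtain t where t: "t \<ge> 0" "x + t *\<^sub>R N \<in> C" by blast
    have "\<exists>t\<ge>0. x + t *\<^sub>R (- N) \<in> C" using not_inside_ray[of "- N" x C] N0 x by auto
    then obtain s where s: "s \<ge> 0" "x + s *\<^sub>R (- N) \<in> C" by blast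
    have 1: "(x + r *\<^sub>R N - q) \<bullet> T = (x - q) \<bullet> T" "(x + r *\<^sub>R N - q) \<bullet> N = (x - q) \<bullet> N + r" for r
      using NT by (auto simp: inner_diff_left inner_add_left)
    define \<xi> \<eta> where "\<xi> = (x - q) \<bullet> T" and "\<eta> = (x - q) \<bullet> N"
    have mem: "x + r *\<^sub>R N \<in> C \<longleftrightarrow> \<xi> \<in> {c..d} \<and> (\<eta> + r = F \<xi> \<or> \<eta> + r = h)" for r
      unfolding C mem_Collect_eq 1 \<xi>_def \<eta>_def by blast
    have cd: "\<xi> \<in> {c..d}" using t(2) unfolding mem by blast
    have ne: "\<eta> \<noteq> F \<xi>" "\<eta> \<noteq> h"
      using xC mem[of 0] cd by auto
    have "\<eta> + t = F \<xi> \<or> \<eta> + t = h" using t(2) unfolding mem by blast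
    then have lt: "\<eta> < h" using t(1) ne Fle[OF cd] by linarith
    have "x + (- s) *\<^sub>R N \<in> C" using s(2) by simp
    then have "\<eta> + - s = F \<xi> \<or> \<eta> + - s = h" unfolding mem by blast
    then have gt: "F \<xi> < \<eta>" using s(1) ne lt by linarith
    then have "\<xi> \<noteq> c" "\<xi> \<noteq> d" using lt Fcd by auto
    then have "\<xi> \<in> {c<..<d}" using cd by simp
    then show "x \<in> ?S" using gt lt unfolding \<xi>_def \<eta>_def by blast
  qed
  show "?S \<subseteq> inside C"
  proof
    fix x assume "x \<in> ?S"
    \<comment> \<open>Clamping the abscissa to \<open>{c..d}\<close> extends \<open>F\<close>
      continuously to the whole line, so that the region is an intersection of open sets and
      \<open>?K\<close> one of closed sets.\<close>
    define G where "G \<xi> = F (max c (min d \<xi>))" for \<xi>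
    have G: "continuous_on UNIV G" unfolding G_def
      by (rule continuous_on_compose2[OF F]) (use cd in \<open>auto intro!: continuous_intros\<close>)
    have GF: "G \<xi> = F \<xi>" if "\<xi> \<in> {c..d}" for \<xi> using that by (simp add: G_def)
    have cG: "continuous_on UNIV (\<lambda>x. G ((x - q) \<bullet> T))"
      by (rule continuous_on_compose2[OF G, where f = "\<lambda>x. (x - q) \<bullet> T"]) (intro continuous_intros, simp)
    have Seq: "?S = {x. c < (x - q) \<bullet> T} \<inter> {x. (x - q) \<bullet> T < d} \<inter> {x. G ((x - q) \<bullet> T) < (x - q) \<bullet> N} \<inter> {x. (x - q) \<bullet> N < h}"
      using GF by (intro set_eqI) (simp only: Int_iff mem_Collect_eq greaterThanLessThan_iff, metis atLeastAtMost_iff less_imp_le)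
    have "open ?S" unfolding Seq
      by (intro open_Int open_Collect_less cG continuous_intros)
    let ?K = "{x. c \<le> (x - q) \<bullet> T} \<inter> {x. (x - q) \<bullet> T \<le> d} \<inter> {x. G ((x - q) \<bullet> T) \<le> (x - q) \<bullet> N} \<inter> {x. (x - q) \<bullet> N \<le> h}"
    have K: "closed ?K" by (intro closed_Int closed_Collect_le cG continuous_intros)
    have "?S \<subseteq> ?K" unfolding Seq by (intro Int_mono Collect_mono impI less_imp_le)
    then have clS: "closure ?S \<subseteq> ?K" using K by (rule closure_minimal)
    \<comment> \<open>On the vertical sides, at abscissa \<open>c\<close> or \<open>d\<close>, the
      graph already has height \<open>h\<close>, so \<open>?K\<close> contributes only end points of
      the chord there.\<close>
    have "?K - ?S \<subseteq> C"
    proof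
      fix y assume y: "y \<in> ?K - ?S"
      then have k: "(y - q) \<bullet> T \<in> {c..d}" "F ((y - q) \<bullet> T) \<le> (y - q) \<bullet> N" "(y - q) \<bullet> N \<le> h"
        using GF[of "(y - q) \<bullet> T"] by (simp_all only: Diff_iff Int_iff mem_Collect_eq atLeastAtMost_iff)
      define \<xi> \<eta> where "\<xi> = (y - q) \<bullet> T" and "\<eta> = (y - q) \<bullet> N"
      have "\<not> (\<xi> \<in> {c<..<d} \<and> F \<xi> < \<eta> \<and> \<eta> < h)" using y unfolding \<xi>_def \<eta>_def by blast
      then have "\<eta> = F \<xi> \<or> \<eta> = h"
        using k Fcd unfolding \<xi>_def[symmetric] \<eta>_def[symmetric]
        by (metis atLeastAtMost_iff greaterThanLessThan_iff order_antisym order_le_less)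
      then show "y \<in> C" using k(1) unfolding C \<xi>_def \<eta>_def by blast
    qed
    then have fr: "frontier ?S \<subseteq> C"
      using clS interior_open[OF \<open>open ?S\<close>] unfolding frontier_def by blast
    have "bounded (F ` {c..d})"
      by (intro compact_imp_bounded compact_continuous_image F compact_Icc)
    then obtain B where B: "\<forall>\<xi>\<in>{c..d}. \<bar>F \<xi>\<bar> \<le> B" unfolding bounded_iff by auto
    have "norm y \<le> norm q + (\<bar>c\<bar> + \<bar>d\<bar>) + (B + \<bar>h\<bar>)" if "y \<in> ?S" for y
    proof -
      have "norm y \<le> norm q + norm (y - q)" by (metis norm_triangle_sub)
      moreover have "norm (y - q) \<le> \<bar>(y - q) \<bullet> T\<bar> + \<bar>(y - q) \<bullet> N\<bar>"
        by (rule norm_le_orthonormal_components[OF ON])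
      moreover have in_box: "c < (y - q) \<bullet> T" "(y - q) \<bullet> T < d" "F ((y - q) \<bullet> T) < (y - q) \<bullet> N" "(y - q) \<bullet> N < h"
        using that by (simp_all only: mem_Collect_eq greaterThanLessThan_iff)
      moreover have "\<bar>F ((y - q) \<bullet> T)\<bar> \<le> B"
        using B in_box by (meson atLeastAtMost_iff less_imp_le)
      ultimately show ?thesis by linarith
    qed
    then have "bounded ?S" unfolding bounded_iff by blast
    then show "x \<in> inside C"
      using \<open>x \<in> ?S\<close> fr
    proof (intro mem_inside_frontier[of x ?S])
      show "?S \<inter> C = {}" unfolding C by force
    qed
  qed
qed

section \<open>Comparison of the section with parabolic caps\<close>

text \<open>Since the abscissa increases strictly along the arc, the arc is the graph of a function
  \<open>F\<close>, and \<open>inside_graph_chord\<close> describes the section. The quadratic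
  bounds on \<open>F\<close> then give both inclusions.\<close>

lemma section_between_parabolic_caps:
  fixes X :: "real \<Rightarrow> real^2" and q T N :: "real^2"
  assumes ON: "norm T = 1" "norm N = 1" "T \<bullet> N = 0"
    and ab: "a < p" "p < b" and X: "continuous_on {a..b} X" and q: "X p = q"
    and mono: "strict_mono_on {a..b} (\<lambda>u. (X u - q) \<bullet> T)"
    and ends: "(X a - q) \<bullet> N = h" "(X b - q) \<bullet> N = h"
    and below: "\<And>u. u \<in> {a<..<b} \<Longrightarrow> (X u - q) \<bullet> N < h"
    and k: "0 < k1" "0 < k2"
    and quad: "\<And>u. u \<in> {a..b} \<Longrightarrow> k1 * ((X u - q) \<bullet> T)\<^sup>2 \<le> (X u - q) \<bullet> N"
      "\<And>u. u \<in> {a..b} \<Longrightarrow> (X u - q) \<bullet> N \<le> k2 * ((X u - q) \<bullet> T)\<^sup>2"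
  defines "S \<equiv> inside (X ` {a..b} \<union> closed_segment (X a) (X b))"
  shows "open S" "parabolic_cap q T N k2 h \<subseteq> S" "S \<subseteq> parabolic_cap q T N k1 h"
proof -
  define f g where "f u = (X u - q) \<bullet> N" and "g u = (X u - q) \<bullet> T" for u
  have cf: "continuous_on {a..b} f" and cg: "continuous_on {a..b} g"
    unfolding f_def g_def by (intro continuous_intros X)+
  have mono_g: "strict_mono_on {a..b} g" using mono unfolding g_def .
  define c d where "c = g a" and "d = g b"
  have g_p: "g p = 0" using q by (simp add: g_def)
  have cd: "c < 0" "0 < d"
    using ab strict_mono_onD[OF mono_g, of a p] strict_mono_onD[OF mono_g, of p b] g_p by (auto simp: c_def d_def)
  have gI: "g u \<in> {c..d}" if "u \<in> {a..b}" for u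
    using that ab strict_mono_on_leD[OF mono_g, of a u] strict_mono_on_leD[OF mono_g, of u b]
    by (auto simp: c_def d_def)
  have g_surj: "\<exists>u\<in>{a..b}. g u = \<xi>" if "\<xi> \<in> {c..d}" for \<xi>
    using IVT'[of g a \<xi> b] that cg ab by (auto simp: c_def d_def)
  \<comment> \<open>The abscissa \<open>g\<close> is a homeomorphism from \<open>{a..b}\<close> onto
    \<open>{c..d}\<close>; composing the height with its inverse yields \<open>F\<close>.\<close>
  define gi where "gi = inv_into {a..b} g"
  have inj: "inj_on g {a..b}" using mono_g by (rule strict_mono_on_imp_inj_on)
  have gi: "gi (g u) = u" if "u \<in> {a..b}" for u unfolding gi_def using inj that by simp
  have img: "g ` {a..b} = {c..d}" using gI g_surj by blast
  have gi_c: "continuous_on {c..d} gi"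
    unfolding img[symmetric] by (rule continuous_on_inv) (use cg gi in auto)
  define F where "F \<xi> = f (gi \<xi>)" for \<xi>
  have gi_in: "gi \<xi> \<in> {a..b}" "g (gi \<xi>) = \<xi>" if "\<xi> \<in> {c..d}" for \<xi>
    using g_surj[OF that] gi by auto
  have F: "continuous_on {c..d} F" unfolding F_def
    by (rule continuous_on_compose2[OF cf gi_c]) (use gi_in in auto)
  have Fg: "F (g u) = f u" if "u \<in> {a..b}" for u unfolding F_def using gi that by simp
  have Fcd: "F c = h" "F d = h"
    using Fg[of a] Fg[of b] ab ends by (auto simp: c_def d_def f_def)
  have Flt: "F \<xi> < h" if "c < \<xi>" "\<xi> < d" for \<xi>
  proof -
    have \<xi>: "\<xi> \<in> {c..d}" using that by simp
    have "gi \<xi> \<noteq> a" "gi \<xi> \<noteq> b" using gi_in(2)[OF \<xi>] that by (auto simp: c_def d_def)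
    then show ?thesis using gi_in(1)[OF \<xi>] below[of "gi \<xi>"] by (simp add: F_def f_def)
  qed
  have dec: "x = q + ((x - q) \<bullet> T) *\<^sub>R T + ((x - q) \<bullet> N) *\<^sub>R N" for x
    unfolding add.assoc orthonormal_components[OF ON, of "x - q", symmetric] by simp
  have seg: "x \<in> closed_segment (X a) (X b) \<longleftrightarrow> (x - q) \<bullet> T \<in> {c..d} \<and> (x - q) \<bullet> N = h" for x
  proof
    assume "x \<in> closed_segment (X a) (X b)"
    then obtain t where t: "0 \<le> t" "t \<le> 1" "x = (1 - t) *\<^sub>R X a + t *\<^sub>R X b"
      unfolding closed_segment_def by blast
    have e: "x - q = (1 - t) *\<^sub>R (X a - q) + t *\<^sub>R (X b - q)" unfolding t(3) by (simp add: algebra_simps)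
    have N: "(x - q) \<bullet> N = h" unfolding e inner_add_left inner_scaleR_left ends by (simp add: algebra_simps)
    have "(x - q) \<bullet> T = (1 - t) * c + t * d"
      unfolding e inner_add_left inner_scaleR_left c_def d_def g_def ..
    also have "\<dots> \<in> {c..d}"
      using t cd convex_bound_le[of "- c" "- c" "- d" "1 - t" t] convex_bound_le[of c d d "1 - t" t] by (simp add: algebra_simps)
    finally show "(x - q) \<bullet> T \<in> {c..d} \<and> (x - q) \<bullet> N = h" using N by simp
  next
    assume x: "(x - q) \<bullet> T \<in> {c..d} \<and> (x - q) \<bullet> N = h"
    \<comment> \<open>The relative position of the abscissa of \<open>x\<close> between
      \<open>c\<close> and \<open>d\<close>, which is the weight of \<open>X b\<close> in the convex
      combination.\<close>
    define t where "t = ((x - q) \<bullet> T - c) / (d - c)"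
    have "t * (d - c) = (x - q) \<bullet> T - c" using cd by (simp add: t_def)
    then have xt: "(x - q) \<bullet> T = (1 - t) * c + t * d" by (simp add: algebra_simps)
    have t: "0 \<le> t" "t \<le> 1" using x cd by (auto simp: t_def divide_simps)
    have Xa: "X a = q + c *\<^sub>R T + h *\<^sub>R N" and Xb: "X b = q + d *\<^sub>R T + h *\<^sub>R N"
      using dec[of "X a"] dec[of "X b"] unfolding ends c_def d_def g_def by blast+
    have "x = q + ((1 - t) * c + t * d) *\<^sub>R T + h *\<^sub>R N"
      by (subst dec[of x]) (simp only: x xt)
    also have "\<dots> = (1 - t) *\<^sub>R X a + t *\<^sub>R X b"
      unfolding Xa Xb by (simp add: algebra_simps)
    finally show "x \<in> closed_segment (X a) (X b)" using t unfolding closed_segment_def by blast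
  qed
  have arc: "x \<in> X ` {a..b} \<longleftrightarrow> (x - q) \<bullet> T \<in> {c..d} \<and> (x - q) \<bullet> N = F ((x - q) \<bullet> T)" for x
  proof
    assume "x \<in> X ` {a..b}"
    then obtain u where u: "u \<in> {a..b}" "x = X u" by blast
    show "(x - q) \<bullet> T \<in> {c..d} \<and> (x - q) \<bullet> N = F ((x - q) \<bullet> T)"
      using gI[OF u(1)] Fg[OF u(1)] unfolding u(2) f_def g_def by simp
  next
    assume x: "(x - q) \<bullet> T \<in> {c..d} \<and> (x - q) \<bullet> N = F ((x - q) \<bullet> T)"
    then obtain u where u: "u \<in> {a..b}" "g u = (x - q) \<bullet> T" using g_surj by blast
    then have "(X u - q) \<bullet> T = (x - q) \<bullet> T" "(X u - q) \<bullet> N = (x - q) \<bullet> N"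
      using Fg[OF u(1)] x unfolding f_def g_def by simp_all
    then have "X u = x" by (subst dec[of "X u"], subst dec[of x]) simp
    then show "x \<in> X ` {a..b}" using u by blast
  qed
  have C: "X ` {a..b} \<union> closed_segment (X a) (X b) =
      {x. (x - q) \<bullet> T \<in> {c..d} \<and> ((x - q) \<bullet> N = F ((x - q) \<bullet> T) \<or> (x - q) \<bullet> N = h)}"
    using arc seg by blast
  have S: "S = {x. (x - q) \<bullet> T \<in> {c<..<d} \<and> F ((x - q) \<bullet> T) < (x - q) \<bullet> N \<and> (x - q) \<bullet> N < h}"
    unfolding S_def
    by (rule inside_graph_chord[OF ON F _ Fcd Flt C]) (use cd in auto)
  have "closed (X ` {a..b} \<union> closed_segment (X a) (X b))"
    by (intro closed_Un closed_segment compact_imp_closed[OF compact_continuous_image[OF X compact_Icc]])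
  then show "open S" unfolding S_def by (rule open_inside)
  have Fq: "k1 * \<xi>\<^sup>2 \<le> F \<xi>" "F \<xi> \<le> k2 * \<xi>\<^sup>2" if \<xi>: "\<xi> \<in> {c..d}" for \<xi>
  proof -
    obtain u where u: "u \<in> {a..b}" "g u = \<xi>" using g_surj \<xi> by blast
    show "k1 * \<xi>\<^sup>2 \<le> F \<xi>" "F \<xi> \<le> k2 * \<xi>\<^sup>2"
      using quad[OF u(1)] Fg[OF u(1)] u(2) by (auto simp: f_def g_def)
  qed
  show "S \<subseteq> parabolic_cap q T N k1 h"
  proof
    fix x assume "x \<in> S"
    then have x: "(x - q) \<bullet> T \<in> {c..d}" "F ((x - q) \<bullet> T) < (x - q) \<bullet> N" "(x - q) \<bullet> N < h"
      unfolding S by (simp_all only: mem_Collect_eq greaterThanLessThan_iff atLeastAtMost_iff less_imp_le)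
    show "x \<in> parabolic_cap q T N k1 h"
      unfolding parabolic_cap_def mem_Collect_eq using x Fq(1)[OF x(1)] by linarith
  qed
  show "parabolic_cap q T N k2 h \<subseteq> S"
  proof
    fix x assume x: "x \<in> parabolic_cap q T N k2 h"
    define \<xi> where "\<xi> = (x - q) \<bullet> T"
    have x: "k2 * \<xi>\<^sup>2 < (x - q) \<bullet> N" "(x - q) \<bullet> N < h"
      using x unfolding parabolic_cap_def \<xi>_def by blast+
    \<comment> \<open>A point of the inner cap must first be shown to lie over the chord. As
      \<open>F\<close> has value \<open>h\<close> at \<open>c\<close> and \<open>d\<close>, the
      parabola with coefficient \<open>k2\<close> has reached height \<open>h\<close> there, so the
      cap is confined to abscissae strictly between them.\<close>
    have "k2 * \<xi>\<^sup>2 < k2 * c\<^sup>2" "k2 * \<xi>\<^sup>2 < k2 * d\<^sup>2"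
      using x Fq(2)[of c] Fq(2)[of d] Fcd cd by auto
    then have "\<xi>\<^sup>2 < (- c)\<^sup>2" "\<xi>\<^sup>2 < d\<^sup>2" using k by auto
    then have "\<bar>\<xi>\<bar> < - c" "\<bar>\<xi>\<bar> < d"
      using cd power2_less_imp_less[of "\<bar>\<xi>\<bar>" "- c"] power2_less_imp_less[of "\<bar>\<xi>\<bar>" d] by simp_all
    then have \<xi>: "\<xi> \<in> {c<..<d}" by auto
    then have "F \<xi> \<le> k2 * \<xi>\<^sup>2" by (intro Fq(2)) auto
    then show "x \<in> S" using x \<xi> unfolding S mem_Collect_eq \<xi>_def[symmetric] by linarith
  qed
qed

section \<open>Distance to the tangent and height of the center of gravity\<close>

text \<open>Every point of the line has the same \<open>N\<close> component, so Cauchy-Schwarz gives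
  the lower bound; the foot of the perpendicular from \<open>G\<close>, with parameter
  \<open>c\<close>, attains it.\<close>

lemma infdist_tangent_line:
  fixes q v N G :: "real^2"
  assumes "v \<noteq> 0" "norm N = 1" "N \<bullet> v = 0"
  shows "infdist G {q + c *\<^sub>R v |c. True} = \<bar>(G - q) \<bullet> N\<bar>"
proof -
  define T where "T = (1 / norm v) *\<^sub>R v"
  have ON: "norm T = 1" "norm N = 1" "T \<bullet> N = 0" using assms by (auto simp: T_def inner_commute)
  have ge: "\<bar>(G - q) \<bullet> N\<bar> \<le> dist G y" if y: "y \<in> {q + c *\<^sub>R v |c. True}" for y
  proof -
    from y obtain c where y: "y = q + c *\<^sub>R v" by blast
    have "(G - q) \<bullet> N = (G - y) \<bullet> N" 
      using assms(3) by (simp add: y inner_diff_left inner_add_left inner_commute[of v])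
    then show ?thesis using Cauchy_Schwarz_ineq2[of "G - y" N] assms(2) by (simp add: dist_norm)
  qed
  define c where "c = ((G - q) \<bullet> T) / norm v"
  have cv: "((G - q) \<bullet> T) *\<^sub>R T = c *\<^sub>R v" by (simp add: c_def T_def)
  have "G - q = c *\<^sub>R v + ((G - q) \<bullet> N) *\<^sub>R N"
    unfolding cv[symmetric] by (rule orthonormal_components[OF ON])
  then have "G - q - c *\<^sub>R v = ((G - q) \<bullet> N) *\<^sub>R N" by (rule diff_eq_eq[THEN iffD2, OF trans[OF _ add.commute]])
  then have "G - (q + c *\<^sub>R v) = ((G - q) \<bullet> N) *\<^sub>R N" unfolding diff_diff_eq .
  then have "dist G (q + c *\<^sub>R v) = \<bar>(G - q) \<bullet> N\<bar>" using assms(2) by (simp add: dist_norm)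
  moreover have "q + c *\<^sub>R v \<in> {q + c *\<^sub>R v |c. True}" by blast
  ultimately have le: "infdist G {q + c *\<^sub>R v |c. True} \<le> \<bar>(G - q) \<bullet> N\<bar>" by (metis infdist_le)
  have "\<bar>(G - q) \<bullet> N\<bar> \<le> infdist G {q + c *\<^sub>R v |c. True}"
    by (subst infdist_notempty) (auto intro!: cINF_greatest intro: ge)
  then show ?thesis using le by simp
qed

text \<open>Turns intersections with the parallel line into solutions of an equation for the height
  above the tangent.\<close>

lemma mem_parallel_line:
  assumes "vderiv X p \<noteq> 0" "norm (N p) = 1" "N p \<bullet> vderiv X p = 0"
  shows "x \<in> parallel_line X N p h \<longleftrightarrow> (x - X p) \<bullet> N p = h"
proof
  assume "x \<in> parallel_line X N p h"
  then obtain c where x: "x = X p + h *\<^sub>R N p + c *\<^sub>R vderiv X p" unfolding parallel_line_def by blast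
  have "(x - X p) \<bullet> N p = h * (N p \<bullet> N p) + c * (N p \<bullet> vderiv X p)"
    unfolding x by (simp add: inner_add_left inner_commute[of "vderiv X p"])
  then show "(x - X p) \<bullet> N p = h" using assms by (simp add: norm_eq_1)
next
  assume h: "(x - X p) \<bullet> N p = h"
  define T where "T = (1 / norm (vderiv X p)) *\<^sub>R vderiv X p"
  have ON: "norm T = 1" "norm (N p) = 1" "T \<bullet> N p = 0" using assms by (auto simp: T_def inner_commute)
  define c where "c = ((x - X p) \<bullet> T) / norm (vderiv X p)"
  have cv: "((x - X p) \<bullet> T) *\<^sub>R T = c *\<^sub>R vderiv X p" by (simp add: c_def T_def)
  have "x - X p = ((x - X p) \<bullet> T) *\<^sub>R T + ((x - X p) \<bullet> N p) *\<^sub>R N p"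
    by (rule orthonormal_components[OF ON])
  also have "\<dots> = c *\<^sub>R vderiv X p + h *\<^sub>R N p" unfolding cv h ..
  finally have "x = c *\<^sub>R vderiv X p + h *\<^sub>R N p + X p" by (rule diff_eq_eq[THEN iffD1])
  then have "x = X p + h *\<^sub>R N p + c *\<^sub>R vderiv X p" by (simp only: ac_simps)
  then show "x \<in> parallel_line X N p h" unfolding parallel_line_def by blast
qed

text \<open>The height of the center of gravity is moment over area. For the lower bound the moment
  is compared with that of the inner cap and the area with that of the outer one; for the upper
  bound the roles are exchanged.\<close>

lemma center_of_gravity_height_bounds:
  fixes q T N :: "real^2"
  assumes ON: "norm T = 1" "norm N = 1" "T \<bullet> N = 0"
    and k: "0 < k1" "0 < k2" and h: "0 < h" and S: "open S"
    and sub: "parabolic_cap q T N k2 h \<subseteq> S" "S \<subseteq> parabolic_cap q T N k1 h"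
  shows "3/5 * sqrt (k1/k2) * h \<le> (center_of_gravity S - q) \<bullet> N"
    and "(center_of_gravity S - q) \<bullet> N \<le> 3/5 * sqrt (k2/k1) * h"
proof -
  have bS: "bounded S" using bounded_parabolic_cap[OF ON k(1)] sub(2) bounded_subset by blast
  have int: "\<phi> integrable_on U" if "continuous_on UNIV \<phi>" "open U" "bounded U" for \<phi> :: "real^2 \<Rightarrow> 'b::euclidean_space" and U
    using absolutely_integrable_continuous_bounded_open[OF that] by (simp add: absolutely_integrable_on_def)
  have c1: "continuous_on UNIV (\<lambda>x. (x - q) \<bullet> N)" by (intro continuous_intros)
  have c0: "continuous_on UNIV (\<lambda>x::real^2. 1::real)" by simp
  let ?P = "\<lambda>k. parabolic_cap q T N k h"
  have oP: "open (?P k)" for k by (rule open_parabolic_cap)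
  have bP: "bounded (?P k)" if "0 < k" for k by (rule bounded_parabolic_cap[OF ON that])
  define A M where "A = integral S (\<lambda>x. 1::real)" and "M = integral S (\<lambda>x. (x - q) \<bullet> N)"
  define A0 where "A0 = integral unit_cap (\<lambda>v. 1::real)"
  have A0: "A0 > 0" unfolding A0_def by (rule unit_cap_area_pos)
  \<comment> \<open>Monotonicity of the moment in the region rests on the height being nonnegative
    on the outer cap.\<close>
  have pos: "0 \<le> (x - q) \<bullet> N" if "x \<in> ?P k1" for x
  proof -
    have "0 \<le> k1 * ((x - q) \<bullet> T)\<^sup>2" using k by simp
    then show ?thesis using that unfolding parabolic_cap_def mem_Collect_eq by linarith
  qed
  have cap: "integral (?P k) (\<lambda>x. 1) = h * sqrt (h/k) * A0"
    "integral (?P k) (\<lambda>x. (x - q) \<bullet> N) = 3/5 * h\<^sup>2 * sqrt (h/k) * A0" if "0 < k" for k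
    using integral_parabolic_cap[OF ON that h, of q] unfolding unit_cap_moment A0_def by simp_all
  have A: "h * sqrt (h/k2) * A0 \<le> A" "A \<le> h * sqrt (h/k1) * A0"
    unfolding cap(1)[OF k(1), symmetric] cap(1)[OF k(2), symmetric] A_def
    by (intro integral_subset_le sub int c0 S bS oP bP k; simp)+
  have M: "3/5 * h\<^sup>2 * sqrt (h/k2) * A0 \<le> M" "M \<le> 3/5 * h\<^sup>2 * sqrt (h/k1) * A0"
    unfolding cap(2)[OF k(1), symmetric] cap(2)[OF k(2), symmetric] M_def
    by (intro integral_subset_le sub int c1 S bS oP bP k; use pos sub in blast)+
  have pos2: "0 < h * sqrt (h/k2) * A0" using h k A0 by simp
  then have Apos: "A > 0" using A(1) by linarith
  have "S \<in> lmeasurable" using S bS by (rule_tac lmeasurable_open) auto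
  then have mS: "measure lebesgue S = A" unfolding A_def by (rule lmeasure_integral)
  \<comment> \<open>Taking the \<open>N\<close> component commutes with the vector-valued integral,
    which expresses the height of the center of gravity as \<open>M / A\<close>.\<close>
  have "integral S (\<lambda>x. (x - q) \<bullet> N) = integral S (\<lambda>x. x) \<bullet> N - A * (q \<bullet> N)"
  proof -
    have 1: "(\<lambda>x. x) integrable_on S" by (rule int) (use S bS in auto)
    have 2: "(\<lambda>x. x \<bullet> N) integrable_on S" by (rule int) (use S bS in \<open>auto intro: continuous_intros\<close>)
    have 3: "(\<lambda>x. q \<bullet> N) integrable_on S" by (rule int) (use S bS in auto)
    have "integral S (\<lambda>x. (x - q) \<bullet> N) = integral S (\<lambda>x. x \<bullet> N) - integral S (\<lambda>x. q \<bullet> N)"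
      unfolding inner_diff_left by (rule integral_diff[OF 2 3])
    moreover have "integral S (\<lambda>x. x \<bullet> N) = integral S (\<lambda>x. x) \<bullet> N"
      using integral_linear[OF 1 bounded_linear_inner_left[of N]] by (simp add: o_def)
    moreover have "integral S (\<lambda>x. q \<bullet> N) = A * (q \<bullet> N)"
      using integral_mult_left[of S "\<lambda>x. 1" "q \<bullet> N"] unfolding A_def by simp
    ultimately show ?thesis by simp
  qed
  then have cM: "(center_of_gravity S - q) \<bullet> N = M / A"
    unfolding center_of_gravity_def mS M_def using Apos by (simp add: inner_diff_left field_simps)
  \<comment> \<open>The factor \<open>sqrt (k1/k2)\<close> turns the area of the outer cap into that
    of the inner one, so the right side is exactly the moment of the inner cap.\<close>
  have "3/5 * sqrt (k1/k2) * h * A \<le> 3/5 * sqrt (k1/k2) * h * (h * sqrt (h/k1) * A0)"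
    using A(2) h k by (intro mult_left_mono) auto
  also have "\<dots> = 3/5 * h\<^sup>2 * sqrt (h/k2) * A0"
    using k h by (simp add: real_sqrt_divide power2_eq_square)
  also note M(1)
  finally show "3/5 * sqrt (k1/k2) * h \<le> (center_of_gravity S - q) \<bullet> N"
    using Apos unfolding cM by (simp only: pos_le_divide_eq)
  note M(2)
  also have "3/5 * h\<^sup>2 * sqrt (h/k1) * A0 = 3/5 * sqrt (k2/k1) * h * (h * sqrt (h/k2) * A0)"
    using k h by (simp add: real_sqrt_divide power2_eq_square)
  also have "\<dots> \<le> 3/5 * sqrt (k2/k1) * h * A"
    using A(1) h k by (intro mult_left_mono) auto
  finally show "(center_of_gravity S - q) \<bullet> N \<le> 3/5 * sqrt (k2/k1) * h"
    using Apos unfolding cM by (simp only: pos_divide_le_eq)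
qed

section \<open>Curvature and the local shape of the curve\<close>

lemma class_C3_has_vector_derivative:
  assumes "class_C 3 f I" "s \<in> I"
  shows "(f has_vector_derivative vderiv f s) (at s)"
    and "(vderiv f has_vector_derivative vderiv (vderiv f) s) (at s)"
proof -
  have d: "\<And>i. i < 3 \<Longrightarrow> (vderiv ^^ i) f differentiable (at s)"
    using assms unfolding class_C_def by blast
  have "f differentiable (at s)" "vderiv f differentiable (at s)"
    using d[of 0] d[of 1] by simp_all
  then show "(f has_vector_derivative vderiv f s) (at s)"
    "(vderiv f has_vector_derivative vderiv (vderiv f) s) (at s)"
    by (simp_all only: vector_derivative_works)
qed

text \<open>Transfers the curvature condition from arc length to the given parameter. The second
  derivative of the reparametrized curve is \<open>?D\<close>; its tangential term is orthogonal to
  \<open>N p\<close>, and the other carries a square factor, which cannot change the sign.\<close>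

lemma strictly_locally_convex_second_derivative:
  assumes "strictly_locally_convex X I N" "p \<in> I"
  shows "0 < vderiv (vderiv X) p \<bullet> N p"
proof -
  from assms(1) obtain \<phi> J where
    X: "class_C 3 X I" and J: "open_interval J" "bij_betw \<phi> J I" "class_C 3 \<phi> J"
    and curv: "\<forall>\<sigma>\<in>J. 0 < vderiv (vderiv (X \<circ> \<phi>)) \<sigma> \<bullet> N (\<phi> \<sigma>)"
    and N: "N p \<bullet> vderiv X p = 0"
    using assms(2) unfolding strictly_locally_convex_def regular_C3_curve_def arc_length_change_def
      unit_normal_to_convex_side_def by blast
  obtain \<sigma> where \<sigma>: "\<sigma> \<in> J" "\<phi> \<sigma> = p" using J(2) assms(2) unfolding bij_betw_def by blast
  have in_I: "\<phi> s \<in> I" if "s \<in> J" for s using J(2) that unfolding bij_betw_def by blast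
  have oJ: "open J" using J(1) unfolding open_interval_def by blast
  have first: "vderiv (X \<circ> \<phi>) s = vderiv \<phi> s *\<^sub>R vderiv X (\<phi> s)" if "s \<in> J" for s
    by (rule vector_derivative_at[OF vector_diff_chain_at])
      (use class_C3_has_vector_derivative(1) J(3) X in_I that in blast)+
  have d1: "(vderiv \<phi> has_real_derivative vderiv (vderiv \<phi>) \<sigma>) (at \<sigma>)"
    using class_C3_has_vector_derivative(2)[OF J(3) \<sigma>(1)] by (simp add: has_real_derivative_iff_has_vector_derivative)
  have d2: "((vderiv X \<circ> \<phi>) has_vector_derivative vderiv \<phi> \<sigma> *\<^sub>R vderiv (vderiv X) p) (at \<sigma>)"
    by (rule vector_diff_chain_at)
      (use class_C3_has_vector_derivative J(3) X \<sigma> assms(2) in blast)+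
  let ?D = "vderiv \<phi> \<sigma> *\<^sub>R (vderiv \<phi> \<sigma> *\<^sub>R vderiv (vderiv X) p) + vderiv (vderiv \<phi>) \<sigma> *\<^sub>R vderiv X p"
  have "((\<lambda>s. vderiv \<phi> s *\<^sub>R (vderiv X \<circ> \<phi>) s) has_vector_derivative ?D) (at \<sigma>)"
    using has_vector_derivative_scaleR[OF d1 d2] unfolding o_apply \<sigma>(2) .
  then have "(vderiv (X \<circ> \<phi>) has_vector_derivative ?D) (at \<sigma>)"
    by (rule has_vector_derivative_transform_within_open[OF _ oJ \<sigma>(1)]) (simp add: first)
  then have "vderiv (vderiv (X \<circ> \<phi>)) \<sigma> = ?D" by (rule vector_derivative_at)
  then have "0 < ?D \<bullet> N p" using curv \<sigma> by metis
  also have "?D \<bullet> N p = (vderiv \<phi> \<sigma>)\<^sup>2 * (vderiv (vderiv X) p \<bullet> N p)"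
    using N by (simp add: inner_add_left inner_commute[of "vderiv X p"] power2_eq_square)
  finally show ?thesis by (simp add: zero_less_mult_iff)
qed

text \<open>Here \<open>f\<close> is the height and \<open>g\<close> the abscissa along the curve.
  Near \<open>p\<close> they behave like \<open>\<kappa>/2 * (u - p)\<^sup>2\<close> and
  \<open>m * (u - p)\<close>, so \<open>f u / (g u)\<^sup>2\<close> tends to
  \<open>\<kappa> / (2 * m\<^sup>2)\<close>, which \<open>k1\<close> and \<open>k2\<close> enclose
  strictly.\<close>

lemma graph_quadratic_bounds_near_tangency:
  fixes f g f' g' :: "real \<Rightarrow> real"
  assumes I: "open I" "p \<in> I"
    and f: "\<And>u. u \<in> I \<Longrightarrow> (f has_real_derivative f' u) (at u)"
    and g: "\<And>u. u \<in> I \<Longrightarrow> (g has_real_derivative g' u) (at u)"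
    and f': "(f' has_real_derivative \<kappa>) (at p)" and g': "isCont g' p"
    and at_p: "f p = 0" "g p = 0" "f' p = 0" "g' p = m"
    and pos: "0 < \<kappa>" "0 < m"
    and k: "k1 < \<kappa> / (2 * m\<^sup>2)" "\<kappa> / (2 * m\<^sup>2) < k2"
  obtains \<delta> where "0 < \<delta>" "{p - \<delta>..p + \<delta>} \<subseteq> I"
    "\<And>u. u \<in> {p - \<delta>..<p} \<Longrightarrow> f' u < 0" "\<And>u. u \<in> {p<..p + \<delta>} \<Longrightarrow> 0 < f' u"
    "\<And>u. u \<in> {p - \<delta>..p + \<delta>} \<Longrightarrow> 0 < g' u"
    "\<And>u. u \<in> {p - \<delta>..p + \<delta>} \<Longrightarrow> k1 * (g u)\<^sup>2 \<le> f u"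
    "\<And>u. u \<in> {p - \<delta>..p + \<delta>} \<Longrightarrow> f u \<le> k2 * (g u)\<^sup>2"
proof -
  have evI: "\<forall>\<^sub>F u in at p. u \<in> I" using I eventually_at_topological by blast
  have evne: "\<forall>\<^sub>F u in at p. u \<noteq> p" by (simp add: eventually_at_filter)
  have lf': "((\<lambda>u. f' u / (u - p)) \<longlongrightarrow> \<kappa>) (at p)"
    using f' at_p unfolding has_field_derivative_iff by simp
  then have ev1: "\<forall>\<^sub>F u in at p. 0 < f' u / (u - p)" using pos(1) by (rule order_tendstoD(1))
  have ev2: "\<forall>\<^sub>F u in at p. 0 < g' u"
    using g' pos(2) unfolding isCont_def at_p by (rule order_tendstoD(1))
  have lg: "((\<lambda>u. g u / (u - p)) \<longlongrightarrow> m) (at p)"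
    using g[OF I(2)] at_p unfolding has_field_derivative_iff by simp
  then have ev3: "\<forall>\<^sub>F u in at p. 0 < g u / (u - p)" using pos(2) by (rule order_tendstoD(1))
  \<comment> \<open>One application of L'Hopital's rule leaves half the difference quotient of
    \<open>f'\<close> at \<open>p\<close>, whose limit is \<open>lf'\<close>.\<close>
  have lf: "((\<lambda>u. f u / (u - p)\<^sup>2) \<longlongrightarrow> \<kappa> / 2) (at p)"
  proof (rule lhopital)
    show "(f \<longlongrightarrow> 0) (at p)" using DERIV_isCont[OF f[OF I(2)]] at_p by (simp add: isCont_def)
    show "((\<lambda>u. (u - p)\<^sup>2) \<longlongrightarrow> 0) (at p)" by (auto intro!: tendsto_eq_intros)
    show "\<forall>\<^sub>F u in at p. (u - p)\<^sup>2 \<noteq> 0" using evne by eventually_elim simp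
    show "\<forall>\<^sub>F u in at p. 2 * (u - p) \<noteq> 0" using evne by eventually_elim simp
    show "\<forall>\<^sub>F u in at p. (f has_real_derivative f' u) (at u)" using evI by eventually_elim (rule f)
    show "\<forall>\<^sub>F u in at p. ((\<lambda>u. (u - p)\<^sup>2) has_real_derivative 2 * (u - p)) (at u)"
      by (intro always_eventually allI) (auto intro!: derivative_eq_intros)
    show "((\<lambda>u. f' u / (2 * (u - p))) \<longlongrightarrow> \<kappa> / 2) (at p)"
      using tendsto_divide[OF lf' tendsto_const[of 2]] by (simp add: mult.commute)
  qed
  have "((\<lambda>u. (f u / (u - p)\<^sup>2) / (g u / (u - p))\<^sup>2) \<longlongrightarrow> (\<kappa> / 2) / m\<^sup>2) (at p)"
    by (intro tendsto_divide lf tendsto_power lg) (use pos in simp)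
  then have lim: "((\<lambda>u. (f u / (u - p)\<^sup>2) / (g u / (u - p))\<^sup>2) \<longlongrightarrow> \<kappa> / (2 * m\<^sup>2)) (at p)" by simp
  have "\<forall>\<^sub>F u in at p. u \<in> I \<and> 0 < f' u / (u - p) \<and> 0 < g' u \<and> k1 * (g u)\<^sup>2 \<le> f u \<and> f u \<le> k2 * (g u)\<^sup>2"
    using evI ev1 ev2 ev3 evne order_tendstoD(1)[OF lim k(1)] order_tendstoD(2)[OF lim k(2)]
  proof eventually_elim
    case (elim u)
    have "g u \<noteq> 0" using elim by auto
    then have g2: "0 < (g u)\<^sup>2" by simp
    have e: "(f u / (u - p)\<^sup>2) / (g u / (u - p))\<^sup>2 = f u / (g u)\<^sup>2"
      using elim(5) by (simp add: power_divide)
    have "k1 * (g u)\<^sup>2 < f u" "f u < k2 * (g u)\<^sup>2"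
      using elim(6,7) unfolding e pos_less_divide_eq[OF g2] pos_divide_less_eq[OF g2] by blast+
    then show ?case using elim by simp
  qed
  then obtain d where d: "d > 0" and all: "\<And>u. u \<noteq> p \<Longrightarrow> dist u p < d \<Longrightarrow>
     u \<in> I \<and> 0 < f' u / (u - p) \<and> 0 < g' u \<and> k1 * (g u)\<^sup>2 \<le> f u \<and> f u \<le> k2 * (g u)\<^sup>2"
    unfolding eventually_at by auto
  \<comment> \<open>Half the radius keeps the closed interval inside the open ball of the
    estimates.\<close>
  have near: "dist u p < d" if "u \<in> {p - d/2..p + d/2}" for u
    using that d by (auto simp: dist_real_def abs_less_iff)
  show thesis
  proof (rule that[of "d/2"])
    show "0 < d/2" using d by simp
    show "{p - d/2..p + d/2} \<subseteq> I"
    proof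
      fix u assume "u \<in> {p - d/2..p + d/2}"
      then show "u \<in> I" using all[of u] near[of u] I(2) by (cases "u = p") auto
    qed
    show "f' u < 0" if "u \<in> {p - d/2..<p}" for u
    proof -
      have "0 < f' u / (u - p)" using all[of u] near[of u] that d by auto
      then show ?thesis using that by (auto simp: zero_less_divide_iff)
    qed
    show "0 < f' u" if "u \<in> {p<..p + d/2}" for u
    proof -
      have "0 < f' u / (u - p)" using all[of u] near[of u] that d by auto
      then show ?thesis using that by (auto simp: zero_less_divide_iff)
    qed
    \<comment> \<open>The eventual estimates exclude \<open>p\<close> itself; there the claims
      follow from \<open>at_p\<close>.\<close>
    fix u assume u: "u \<in> {p - d/2..p + d/2}"
    show "0 < g' u" using all[of u] near[OF u] at_p pos by (cases "u = p") auto
    show "k1 * (g u)\<^sup>2 \<le> f u" using all[of u] near[OF u] at_p by (cases "u = p") auto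
    show "f u \<le> k2 * (g u)\<^sup>2" using all[of u] near[OF u] at_p by (cases "u = p") auto
  qed
qed

text \<open>The intermediate value theorem gives a crossing, and strict monotonicity keeps
  \<open>f\<close> below the level before it. The sign of \<open>f'\<close> is required only to the
  right of \<open>p\<close>, since the height has derivative 0 at the point of tangency.\<close>

lemma level_crossing_right:
  fixes f :: "real \<Rightarrow> real"
  assumes "p < e" and f: "\<And>u. u \<in> {p..e} \<Longrightarrow> (f has_real_derivative f' u) (at u)"
    and pos: "\<And>u. u \<in> {p<..e} \<Longrightarrow> 0 < f' u"
    and h: "f p < h" "h < f e"
  obtains b where "p < b" "b < e" "f b = h" "\<And>u. u \<in> {p..<b} \<Longrightarrow> f u < h"
proof -
  have cont: "continuous_on {p..e} f" by (rule DERIV_continuous_on[OF has_field_derivative_at_within[OF f]])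
  obtain b where b: "p \<le> b" "b \<le> e" "f b = h" using IVT'[of f p h e] cont h assms(1) by auto
  then have bs: "p < b" "b < e" using h by (auto simp: order_le_less)
  have "f u < f b" if u: "u \<in> {p..<b}" for u
  proof (rule DERIV_pos_imp_increasing_open[of u b f])
    show "u < b" using u by simp
    show "continuous_on {u..b} f" using cont by (rule continuous_on_subset) (use u b in auto)
    show "\<exists>y. (f has_real_derivative y) (at x) \<and> 0 < y" if "u < x" "x < b" for x
      using f[of x] pos[of x] that u b by (intro exI[of _ "f' x"]) auto
  qed
  then show thesis using that bs b by blast
qed

text \<open>The reflection of the parameter reduces this to
  \<open>level_crossing_right\<close>.\<close>

lemma level_crossing_left:
  fixes f :: "real \<Rightarrow> real"
  assumes "e < p" and f: "\<And>u. u \<in> {e..p} \<Longrightarrow> (f has_real_derivative f' u) (at u)"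
    and neg: "\<And>u. u \<in> {e..<p} \<Longrightarrow> f' u < 0"
    and h: "f p < h" "h < f e"
  obtains a where "e < a" "a < p" "f a = h" "\<And>u. u \<in> {a<..p} \<Longrightarrow> f u < h"
proof (rule level_crossing_right[of "- p" "- e" "\<lambda>u. f (- u)" "\<lambda>u. - f' (- u)" h])
  show "((\<lambda>u. f (- u)) has_real_derivative - f' (- u)) (at u)" if "u \<in> {- p..- e}" for u
    using DERIV_chain2[OF f[of "- u"] DERIV_minus[OF DERIV_ident]] that by simp
  show "0 < - f' (- u)" if "u \<in> {- p<..- e}" for u using neg[of "- u"] that by simp
  fix b assume b: "- p < b" "b < - e" "f (- b) = h" "\<And>u. u \<in> {- p..<b} \<Longrightarrow> f (- u) < h"
  show thesis
  proof (rule that[of "- b"])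
    fix u assume "u \<in> {- b<..p}"
    then show "f u < h" using b(4)[of "- u"] by simp
  qed (use b in auto)
qed (use assms(1) h in simp_all)

section \<open>Squeezing the quotient to its limit\<close>

text \<open>\<open>r\<close> is the slack factor: the comparison parabolas have coefficients
  \<open>k / r\<close> and \<open>k * r\<close>. Their quotient is the square of \<open>r\<close>,
  and the square roots in \<open>center_of_gravity_height_bounds\<close> reduce it to
  \<open>r\<close>.\<close>

lemma dist_center_tangent_bounds:
  assumes slc: "strictly_locally_convex X I N" and p: "p \<in> I" and r: "1 < (r::real)"
  shows "\<forall>\<^sub>F h in at_right 0. 3/5 / r \<le> dist_center_tangent X I N p h / h
      \<and> dist_center_tangent X I N p h / h \<le> 3/5 * r"
proof -
  have X: "class_C 3 X I" and I: "open_interval I" and X'0: "vderiv X p \<noteq> 0"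
    and N: "norm (N p) = 1" "N p \<bullet> vderiv X p = 0"
    using slc p unfolding strictly_locally_convex_def regular_C3_curve_def unit_normal_to_convex_side_def
    by blast+
  have oI: "open I" using I unfolding open_interval_def by blast
  note dX = class_C3_has_vector_derivative(1)[OF X] and dX' = class_C3_has_vector_derivative(2)[OF X]
  define q m \<kappa> where "q = X p" and "m = norm (vderiv X p)" and "\<kappa> = vderiv (vderiv X) p \<bullet> N p"
  define T where "T = (1 / m) *\<^sub>R vderiv X p"
  have m: "m > 0" using X'0 by (simp add: m_def)
  have \<kappa>: "\<kappa> > 0" unfolding \<kappa>_def by (rule strictly_locally_convex_second_derivative[OF slc p])
  have ON: "norm T = 1" "norm (N p) = 1" "T \<bullet> N p = 0"
    using m N by (simp_all add: T_def m_def[symmetric] inner_commute)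
  have X'T: "vderiv X p \<bullet> T = m"
    using m by (simp add: T_def power2_norm_eq_inner[symmetric] m_def power2_eq_square)
  define f g where "f u = (X u - q) \<bullet> N p" and "g u = (X u - q) \<bullet> T" for u
  define f' g' where "f' u = vderiv X u \<bullet> N p" and "g' u = vderiv X u \<bullet> T" for u
  have df: "(f has_real_derivative f' u) (at u)" and dg: "(g has_real_derivative g' u) (at u)" if "u \<in> I" for u
    unfolding f_def g_def f'_def g'_def has_real_derivative_iff_has_vector_derivative
    by (auto intro!: bounded_linear.has_vector_derivative[OF bounded_linear_inner_left] derivative_eq_intros dX that)
  have df': "(f' has_real_derivative \<kappa>) (at p)"
    unfolding f'_def \<kappa>_def has_real_derivative_iff_has_vector_derivative
    by (auto intro!: bounded_linear.has_vector_derivative[OF bounded_linear_inner_left] dX' p)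
  have cg': "isCont g' p"
    unfolding g'_def by (intro continuous_intros has_vector_derivative_continuous[OF dX'[OF p]])
  \<comment> \<open>The second-order coefficient of the curve as a graph over its tangent, that is,
    half the curvature at \<open>p\<close>.\<close>
  define k where "k = \<kappa> / (2 * m\<^sup>2)"
  have k: "k > 0" using \<kappa> m by (simp add: k_def)
  have kr: "k / r < k" "k < k * r" using k r by (auto simp: divide_simps)
  have at_p: "f p = 0" "g p = 0" "f' p = 0" "g' p = m"
    using N X'T by (auto simp: f_def g_def f'_def g'_def q_def inner_commute)
  obtain \<delta> where \<delta>: "0 < \<delta>" "{p - \<delta>..p + \<delta>} \<subseteq> I"
    "\<And>u. u \<in> {p - \<delta>..<p} \<Longrightarrow> f' u < 0" "\<And>u. u \<in> {p<..p + \<delta>} \<Longrightarrow> 0 < f' u"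
    "\<And>u. u \<in> {p - \<delta>..p + \<delta>} \<Longrightarrow> 0 < g' u"
    "\<And>u. u \<in> {p - \<delta>..p + \<delta>} \<Longrightarrow> k / r * (g u)\<^sup>2 \<le> f u"
    "\<And>u. u \<in> {p - \<delta>..p + \<delta>} \<Longrightarrow> f u \<le> k * r * (g u)\<^sup>2"
    using graph_quadratic_bounds_near_tangency[OF oI p df dg df' cg' at_p \<kappa> m kr[unfolded k_def]]
    unfolding k_def by metis
  have df\<delta>: "(f has_real_derivative f' u) (at u)" if "u \<in> {p - \<delta>..p + \<delta>}" for u
    using \<delta>(2) that by (blast intro: df)
  \<comment> \<open>The height rises strictly from \<open>p\<close> to both ends of the interval, so
    every positive level below the smaller end value \<open>h0\<close> is crossed on each side of
    \<open>p\<close>.\<close>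
  have "f p < f (p + \<delta>)"
  proof (rule DERIV_pos_imp_increasing_open[of p "p + \<delta>" f])
    show "continuous_on {p..p + \<delta>} f"
      by (rule DERIV_continuous_on[OF has_field_derivative_at_within[OF df]]) (use \<delta>(1,2) in auto)
    show "\<exists>y. (f has_real_derivative y) (at x) \<and> 0 < y" if "p < x" "x < p + \<delta>" for x
      using df[of x] \<delta>(2) \<delta>(4)[of x] that by (intro exI[of _ "f' x"]) (auto simp: subset_iff)
  qed (use \<delta>(1) in simp)
  have "f p < f (p - \<delta>)"
  proof (rule DERIV_neg_imp_decreasing_open[of "p - \<delta>" p f])
    show "continuous_on {p - \<delta>..p} f"
      by (rule DERIV_continuous_on[OF has_field_derivative_at_within[OF df]]) (use \<delta>(1,2) in auto)
    show "\<exists>y. (f has_real_derivative y) (at x) \<and> y < 0" if "p - \<delta> < x" "x < p" for x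
      using df[of x] \<delta>(2) \<delta>(3)[of x] that by (intro exI[of _ "f' x"]) (auto simp: subset_iff)
  qed (use \<delta>(1) in simp)
  define h0 where "h0 = min (f (p - \<delta>)) (f (p + \<delta>))"
  have h0: "h0 > 0" using \<open>f p < f (p + \<delta>)\<close> \<open>f p < f (p - \<delta>)\<close> at_p by (simp add: h0_def)
  have "3/5 / r \<le> dist_center_tangent X I N p h / h \<and> dist_center_tangent X I N p h / h \<le> 3/5 * r"
    if h: "0 < h" "h < h0" for h
  proof -
    obtain b where b: "p < b" "b < p + \<delta>" "f b = h" "\<And>u. u \<in> {p..<b} \<Longrightarrow> f u < h"
      by (rule level_crossing_right[of p "p + \<delta>" f f' h]) (use \<delta>(1,3,4) df\<delta> h at_p(1) h0_def in auto)
    obtain a where a: "p - \<delta> < a" "a < p" "f a = h" "\<And>u. u \<in> {a<..p} \<Longrightarrow> f u < h"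
      by (rule level_crossing_left[of "p - \<delta>" p f f' h]) (use \<delta>(1,3,4) df\<delta> h at_p(1) h0_def in auto)
    have sub: "{a..b} \<subseteq> {p - \<delta>..p + \<delta>}" using a b by auto
    have abI: "{a..b} \<subseteq> I" using sub \<delta>(2) by blast
    have below: "f u < h" if "u \<in> {a<..<b}" for u
      using a(4)[of u] b(4)[of u] that by (cases "u \<le> p") auto
    have mono: "strict_mono_on {a..b} g"
    proof (rule strict_mono_onI)
      fix u v assume uv: "u \<in> {a..b}" "v \<in> {a..b}" "u < v"
      have uvI: "{u..v} \<subseteq> I" "{u..v} \<subseteq> {p - \<delta>..p + \<delta>}" using uv abI sub by auto
      show "g u < g v"
      proof (rule DERIV_pos_imp_increasing[of u v g, OF uv(3)])
        fix x assume "u \<le> x" "x \<le> v"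
        then show "\<exists>y. (g has_real_derivative y) (at x) \<and> 0 < y"
          using dg[of x] \<delta>(5)[of x] uvI by (intro exI[of _ "g' x"]) (auto simp: subset_iff)
      qed
    qed
    have cX: "continuous_on {a..b} X"
      using dX abI by (intro continuous_at_imp_continuous_on) (auto intro: has_vector_derivative_continuous)
    have par: "x \<in> parallel_line X N p h \<longleftrightarrow> (x - q) \<bullet> N p = h" for x
      unfolding q_def by (rule mem_parallel_line[of X p N, OF X'0 N])
    have cut: "cut_parameters X I N p h a b"
      unfolding cut_parameters_def par f_def[symmetric]
    proof (intro conjI ballI)
      show "f u \<noteq> h" if "u \<in> {a<..<b}" for u using below[OF that] by simp
    qed (use a(2,3) b(1,3) abI in \<open>auto simp: subset_iff\<close>)
    define S where "S = inside (X ` {a..b} \<union> closed_segment (X a) (X b))"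
    \<comment> \<open>Cut parameters are unique, so the definite description denotes the region
      given by the pair \<open>a\<close>, \<open>b\<close> just found.\<close>
    have sec: "curve_section X I N p h = S"
      unfolding curve_section_def
    proof (rule the_equality)
      show "\<exists>a b. cut_parameters X I N p h a b \<and> S = inside (X ` {a..b} \<union> closed_segment (X a) (X b))"
        using cut S_def by blast
      show "S' = S" if "\<exists>a b. cut_parameters X I N p h a b \<and> S' = inside (X ` {a..b} \<union> closed_segment (X a) (X b))" for S'
        using that cut_parameters_unique[OF cut] unfolding S_def by blast
    qed
    have kp: "0 < k / r" "0 < k * r" using k r by auto
    have quad: "k / r * (g u)\<^sup>2 \<le> f u" "f u \<le> k * r * (g u)\<^sup>2" if "u \<in> {a..b}" for u
      using \<delta>(6,7)[of u] sub that by blast+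
    note caps = section_between_parabolic_caps[OF ON a(2) b(1) cX q_def[symmetric]
        mono[unfolded g_def[abs_def]] a(3)[unfolded f_def] b(3)[unfolded f_def] below[unfolded f_def]
        kp quad[unfolded f_def g_def], folded S_def]
    have d: "dist_center_tangent X I N p h = \<bar>(center_of_gravity S - q) \<bullet> N p\<bar>"
      unfolding dist_center_tangent_def sec tangent_line_def q_def
      by (rule infdist_tangent_line[of "vderiv X p" "N p", OF X'0 N])
    have "sqrt ((k / r) / (k * r)) = 1 / r" "sqrt ((k * r) / (k / r)) = r"
      using k r by (simp_all add: real_sqrt_divide real_sqrt_mult)
    then have lo: "3/5 / r * h \<le> (center_of_gravity S - q) \<bullet> N p"
      and hi: "(center_of_gravity S - q) \<bullet> N p \<le> 3/5 * r * h"
      using center_of_gravity_height_bounds[OF ON kp h(1) caps] by simp_all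
    \<comment> \<open>The lower bound is nonnegative, which removes the absolute value from the
      distance.\<close>
    have "0 \<le> 3/5 / r * h" using r h by simp
    then have "dist_center_tangent X I N p h = (center_of_gravity S - q) \<bullet> N p" using d lo by linarith
    then show ?thesis using lo hi h(1) by (simp only: pos_le_divide_eq pos_divide_le_eq)
  qed
  then show ?thesis
    unfolding eventually_at_right_field using h0 by blast
qed

theorem theorem2:
  fixes X N :: "real \<Rightarrow> real^2" and I :: "real set" and p :: real
  assumes "strictly_locally_convex X I N"
    and "p \<in> I"
  shows "((\<lambda>h. dist_center_tangent X I N p h / h) \<longlongrightarrow> 3 / 5) (at_right 0)"
proof (rule tendstoI)
  fix e :: real assume e: "0 < e"
  \<comment> \<open>The slack factor is \<open>1 + e\<close>. It causes an error of
    \<open>3/5 * e\<close> above and, by this estimate, at most \<open>3/5 * e\<close> below, both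
    smaller than \<open>e\<close>.\<close>
  have "1 - e \<le> 1 / (1 + e)" by (subst pos_le_divide_eq) (use e in \<open>auto simp: algebra_simps\<close>)
  moreover have "3/5 / (1 + e) = 3/5 * (1 / (1 + e))" by simp
  ultimately have e': "3/5 - 3/5 / (1 + e) < e" using e by linarith
  have "1 < 1 + e" using e by simp
  from dist_center_tangent_bounds[OF assms this]
  show "\<forall>\<^sub>F h in at_right 0. dist (dist_center_tangent X I N p h / h) (3/5) < e"
  proof (rule eventually_mono)
    fix h assume "3/5 / (1 + e) \<le> dist_center_tangent X I N p h / h
      \<and> dist_center_tangent X I N p h / h \<le> 3/5 * (1 + e)"
    moreover have "3/5 * (1 + e) < 3/5 + e" using e by simp
    ultimately show "dist (dist_center_tangent X I N p h / h) (3/5) < e"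
      using e' unfolding dist_real_def abs_less_iff by linarith
  qed
qed

end
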